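(* If $X_1^2+\dots+X_5^2=X_6^2$ for some $X_1,\dots,X_4\in\mathbb{R}_{11}$ and $X_5,X_6\in\mathbb{R}_{22}$ such that $X_5+X_6\in\mathbb{R}_{20}$ and $X_5-X_6\in\mathbb{R}_{02}$ have degree $2$, then for some $A\in\mathbb{H}_{10}$ and $B\in\mathbb{H}_{01}$ we have $$X_1+iX_2+jX_3+kX_4=AB\quad\text{or}\quad X_1+iX_2+jX_3+kX_4=BA.$$
   Context: $\mathbb{H}$ is the skew field of quaternions with the standard imaginary units $i,j,k$. $\mathbb{H}_{mn}\subset\mathbb{H}[u,v]$ (respectively $\mathbb{R}_{mn}\subset\mathbb{R}[u,v]$) is the set of polynomials with quaternionic (respectively real) coefficients of degree at most $m$ in $u$ and at most $n$ in $v$; the variables $u,v$ commute with each other and with the coefficients. *)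

theory Defs
  imports Complex_Main "HOL-Library.Poly_Mapping" "HOL-Library.Product_Plus"
begin

section \<open>Quaternions\<close>

codatatype quat = Quat (qRe: real) (qI: real) (qJ: real) (qK: real)

lemma quat_eqI [intro?]:
  "qRe x = qRe y \<Longrightarrow> qI x = qI y \<Longrightarrow> qJ x = qJ y \<Longrightarrow> qK x = qK y \<Longrightarrow> x = y"
  by (rule quat.expand) simp

lemma quat_eq_iff:
  "x = y \<longleftrightarrow> qRe x = qRe y \<and> qI x = qI y \<and> qJ x = qJ y \<and> qK x = qK y"
  by (auto intro: quat.expand)

instantiation quat :: ab_group_add
begin

primcorec zero_quat where
  "qRe 0 = 0" | "qI 0 = 0" | "qJ 0 = 0" | "qK 0 = 0"

primcorec plus_quat where
  "qRe (x + y) = qRe x + qRe y"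
| "qI (x + y) = qI x + qI y"
| "qJ (x + y) = qJ x + qJ y"
| "qK (x + y) = qK x + qK y"

primcorec uminus_quat where
  "qRe (- x) = - qRe x"
| "qI (- x) = - qI x"
| "qJ (- x) = - qJ x"
| "qK (- x) = - qK x"

primcorec minus_quat where
  "qRe (x - y) = qRe x - qRe y"
| "qI (x - y) = qI x - qI y"
| "qJ (x - y) = qJ x - qJ y"
| "qK (x - y) = qK x - qK y"

instance
  by standard (simp_all add: quat_eq_iff)

end

instantiation quat :: real_algebra_1
begin

primcorec one_quat where
  "qRe 1 = 1" | "qI 1 = 0" | "qJ 1 = 0" | "qK 1 = 0"

primcorec times_quat where
  "qRe (x * y) = qRe x * qRe y - qI x * qI y - qJ x * qJ y - qK x * qK y"
| "qI (x * y) = qRe x * qI y + qI x * qRe y + qJ x * qK y - qK x * qJ y"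
| "qJ (x * y) = qRe x * qJ y - qI x * qK y + qJ x * qRe y + qK x * qI y"
| "qK (x * y) = qRe x * qK y + qI x * qJ y - qJ x * qI y + qK x * qRe y"

primcorec scaleR_quat where
  "qRe (scaleR r x) = r * qRe x"
| "qI (scaleR r x) = r * qI x"
| "qJ (scaleR r x) = r * qJ x"
| "qK (scaleR r x) = r * qK x"

instance
  by standard (simp_all add: quat_eq_iff algebra_simps)

end

definition quat_normsq :: "quat \<Rightarrow> real"
  where "quat_normsq x = (qRe x)\<^sup>2 + (qI x)\<^sup>2 + (qJ x)\<^sup>2 + (qK x)\<^sup>2"

lemma quat_normsq_eq_0_iff [simp]: "quat_normsq x = 0 \<longleftrightarrow> x = 0"
  by (simp add: quat_normsq_def quat_eq_iff add_nonneg_eq_0_iff)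

instantiation quat :: real_div_algebra
begin

primcorec inverse_quat where
  "qRe (inverse x) = qRe x / quat_normsq x"
| "qI (inverse x) = - qI x / quat_normsq x"
| "qJ (inverse x) = - qJ x / quat_normsq x"
| "qK (inverse x) = - qK x / quat_normsq x"

definition "x div y = x * inverse y" for x y :: quat

instance
proof
  fix x y :: quat
  show "x div y = x * inverse y"
    by (rule divide_quat_def)
  show "inverse (0::quat) = 0"
    by (simp add: quat_eq_iff)
  assume "x \<noteq> 0"
  then have n: "quat_normsq x \<noteq> 0"
    by simp
  have e: "qRe x * qRe x + qI x * qI x + qJ x * qJ x + qK x * qK x = quat_normsq x"
    by (simp add: quat_normsq_def power2_eq_square)
  show "inverse x * x = 1" "x * inverse x = 1"
    using n e by (simp_all add: quat_eq_iff field_simps)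
qed

end

definition quat_i :: quat where "quat_i = Quat 0 1 0 0"
definition quat_j :: quat where "quat_j = Quat 0 0 1 0"
definition quat_k :: quat where "quat_k = Quat 0 0 0 1"

lemma quat_units_mult:
  "quat_i * quat_i = -1" "quat_j * quat_j = -1" "quat_k * quat_k = -1"
  "quat_i * quat_j = quat_k" "quat_j * quat_k = quat_i" "quat_k * quat_i = quat_j"
  "quat_j * quat_i = - quat_k" "quat_k * quat_j = - quat_i" "quat_i * quat_k = - quat_j"
  by (simp_all add: quat_eq_iff quat_i_def quat_j_def quat_k_def)

lemma quat_of_real_sel [simp]:
  "qRe (of_real r) = r" "qI (of_real r) = 0" "qJ (of_real r) = 0" "qK (of_real r) = 0"
  by (simp_all add: of_real_def)

lemma Quat_eq:
  "Quat a b c d = of_real a + quat_i * of_real b + quat_j * of_real c + quat_k * of_real d"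
  by (simp add: quat_eq_iff quat_i_def quat_j_def quat_k_def)


section \<open>Polynomials in two variables\<close>

text \<open>
  A polynomial in \<open>u\<close>, \<open>v\<close> is its finitely supported family of coefficients, indexed
  by the pair of exponents of \<open>u\<close> and \<open>v\<close>. The product of \<open>\<Rightarrow>\<^sub>0\<close> is convolution, which
  multiplies coefficients in the given order and adds exponents, so over a
  noncommutative ring the variables are central.
\<close>

type_synonym 'a bipoly = "nat \<times> nat \<Rightarrow>\<^sub>0 'a"

definition bipolys :: "nat \<Rightarrow> nat \<Rightarrow> 'a::zero bipoly set"
  where "bipolys m n = {p. \<forall>(a, b) \<in> Poly_Mapping.keys p. a \<le> m \<and> b \<le> n}"

abbreviation R_polys :: "nat \<Rightarrow> nat \<Rightarrow> real bipoly set"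
  where "R_polys \<equiv> bipolys"

abbreviation H_polys :: "nat \<Rightarrow> nat \<Rightarrow> quat bipoly set"
  where "H_polys \<equiv> bipolys"

text \<open>The zero polynomial gets degree \<open>0\<close>.\<close>

definition total_degree :: "'a::zero bipoly \<Rightarrow> nat"
  where "total_degree p = Max (insert 0 ((\<lambda>(a, b). a + b) ` Poly_Mapping.keys p))"

definition const_bipoly :: "'a::zero \<Rightarrow> 'a bipoly"
  where "const_bipoly c = Poly_Mapping.single (0, 0) c"

text \<open>The inclusion of real into quaternionic polynomials.\<close>

definition quat_bipoly :: "real bipoly \<Rightarrow> quat bipoly"
  where "quat_bipoly p = Poly_Mapping.map of_real p"

lemma lookup_quat_bipoly [simp]:
  "Poly_Mapping.lookup (quat_bipoly p) x = of_real (Poly_Mapping.lookup p x)"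
  by (simp add: quat_bipoly_def Poly_Mapping.map.rep_eq when_def)

end

theory Submission
  imports Defs
begin

text \<open>
  Write \<open>Q = X1 + i X2 + j X3 + k X4 = d u v + b u + c v + a\<close>. The hypothesis says that
  \<open>|Q|\<^sup>2 = P(u) R(v)\<close> with \<open>P\<close> and \<open>R\<close> of degree \<open>2\<close>, so \<open>d \<noteq> 0\<close>, and dividing by \<open>d\<close> on the
  left we may assume \<open>d = 1\<close>. After real translations of \<open>u\<close> and \<open>v\<close> both \<open>b\<close> and \<open>c\<close> are purely
  imaginary, and comparing coefficients gives \<open>Re a = - b \<sqdot> c\<close>, \<open>Im a \<bottom> b, c\<close> and
  \<open>|a| = |b| |c|\<close>. Hence \<open>Im a = \<plusminus> b \<times> c\<close>, that is, \<open>a = b c\<close> or \<open>a = c b\<close>, and so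
  \<open>Q = (v + b) (u + c)\<close> or \<open>Q = (u + c) (v + b)\<close>.
\<close>

section \<open>Inner products of quaternions and the factorization at the level of
  coefficients\<close>

text \<open>The polarization of \<open>quat_normsq\<close>. The coefficients of |Q|^2 are sums of
  such products of coefficients of Q.\<close>

definition quat_inner :: "quat \<Rightarrow> quat \<Rightarrow> real"
  where "quat_inner x y = qRe x * qRe y + qI x * qI y + qJ x * qJ y + qK x * qK y"

text \<open>Polarized multiplicativity of the norm; this is what permits division by the leading
  coefficient.\<close>

lemma quat_inner_mult_left:
  "quat_inner (d * x) (d * y) = quat_inner d d * quat_inner x y"
  unfolding quat_inner_def times_quat.sel by (simp add: algebra_simps)

lemma quat_inner_self_pos: "d \<noteq> 0 \<Longrightarrow> quat_inner d d > 0"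
proof -
  assume "d \<noteq> 0"
  moreover have "quat_inner d d = quat_normsq d"
    by (simp add: quat_inner_def quat_normsq_def power2_eq_square)
  moreover have "quat_normsq d \<ge> 0"
    by (simp add: quat_normsq_def)
  ultimately show ?thesis
    by (metis order_le_less quat_normsq_eq_0_iff)
qed

text \<open>A vector m orthogonal to b and c is parallel to n = b x c when n is nonzero, and equal
  length leaves only the sign open; when n = 0, the length forces m = 0. Lagrange's identity treats
  both cases at once, as equality in Cauchy-Schwarz.\<close>

lemma orthogonal_eq_cross_or_minus_cross:
  fixes b1 b2 b3 c1 c2 c3 m1 m2 m3 :: real
  defines "n1 \<equiv> b2 * c3 - b3 * c2" and "n2 \<equiv> b3 * c1 - b1 * c3" and "n3 \<equiv> b1 * c2 - b2 * c1"
  assumes mb: "m1 * b1 + m2 * b2 + m3 * b3 = 0"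
    and mc: "m1 * c1 + m2 * c2 + m3 * c3 = 0"
    and norm: "m1\<^sup>2 + m2\<^sup>2 + m3\<^sup>2 = n1\<^sup>2 + n2\<^sup>2 + n3\<^sup>2"
  shows "(m1 = n1 \<and> m2 = n2 \<and> m3 = n3) \<or> (m1 = - n1 \<and> m2 = - n2 \<and> m3 = - n3)"
proof -
  let ?N = "n1\<^sup>2 + n2\<^sup>2 + n3\<^sup>2" and ?mn = "m1 * n1 + m2 * n2 + m3 * n3"
  \<comment> \<open>\<open>m \<times> (b \<times> c) = (m \<sqdot> c) b - (m \<sqdot> b) c = 0\<close>\<close>
  have cross: "m2 * n3 - m3 * n2 = 0" "m3 * n1 - m1 * n3 = 0" "m1 * n2 - m2 * n1 = 0"
  proof -
    have "m2 * n3 - m3 * n2 = b1 * (m1 * c1 + m2 * c2 + m3 * c3) - c1 * (m1 * b1 + m2 * b2 + m3 * b3)"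
      "m3 * n1 - m1 * n3 = b2 * (m1 * c1 + m2 * c2 + m3 * c3) - c2 * (m1 * b1 + m2 * b2 + m3 * b3)"
      "m1 * n2 - m2 * n1 = b3 * (m1 * c1 + m2 * c2 + m3 * c3) - c3 * (m1 * b1 + m2 * b2 + m3 * b3)"
      unfolding n1_def n2_def n3_def by (simp_all add: algebra_simps)
    then show "m2 * n3 - m3 * n2 = 0" "m3 * n1 - m1 * n3 = 0" "m1 * n2 - m2 * n1 = 0"
      unfolding mb mc by simp_all
  qed
  \<comment> \<open>Lagrange's identity\<close>
  have "?mn\<^sup>2 = (m1\<^sup>2 + m2\<^sup>2 + m3\<^sup>2) * ?N
      - ((m2 * n3 - m3 * n2)\<^sup>2 + (m3 * n1 - m1 * n3)\<^sup>2 + (m1 * n2 - m2 * n1)\<^sup>2)"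
    by (simp add: power2_eq_square algebra_simps)
  then have "?mn\<^sup>2 = ?N\<^sup>2"
    unfolding cross norm by (simp add: power2_eq_square)
  then consider "?mn = ?N" | "?mn = - ?N"
    using power2_eq_iff by blast
  then show ?thesis
  proof cases
    case 1
    \<comment> \<open>Expand |m - n|^2 = |m|^2 + |n|^2 - 2 (m . n), where all three quantities equal
      \<open>?N\<close>.\<close>
    then have "(m1 - n1)\<^sup>2 + (m2 - n2)\<^sup>2 + (m3 - n3)\<^sup>2 = 0"
      using norm by (simp add: power2_diff)
    then have "m1 - n1 = 0 \<and> m2 - n2 = 0 \<and> m3 - n3 = 0"
      by (simp add: add_nonneg_eq_0_iff)
    then show ?thesis by simp
  next
    case 2
    then have "(m1 + n1)\<^sup>2 + (m2 + n2)\<^sup>2 + (m3 + n3)\<^sup>2 = 0"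
      using norm by (simp add: power2_sum)
    then have "m1 + n1 = 0 \<and> m2 + n2 = 0 \<and> m3 + n3 = 0"
      by (simp add: add_nonneg_eq_0_iff)
    then show ?thesis by (simp add: eq_neg_iff_add_eq_0)
  qed
qed

text \<open>The case of leading coefficient 1. The translations replace u by u - Re c and v by v -
  Re b; the imaginary part of the new constant term is then plus or minus the cross product of Im b
  and Im c, and the sign decides the order of the factors.\<close>

lemma quat_eq_mult_or_mult_swap:
  assumes uv: "quat_inner 1 a + quat_inner b c = 2 * (quat_inner 1 b * quat_inner 1 c)"
    and u: "quat_inner a b = quat_inner 1 c * quat_inner b b"
    and v: "quat_inner a c = quat_inner 1 b * quat_inner c c"
    and one: "quat_inner a a = quat_inner b b * quat_inner c c"
  shows "a = c * b \<or> a = b * c"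
proof -
  obtain a0 a1 a2 a3 where a: "a = Quat a0 a1 a2 a3" by (cases a)
  obtain b0 b1 b2 b3 where b: "b = Quat b0 b1 b2 b3" by (cases b)
  obtain c0 c1 c2 c3 where c: "c = Quat c0 c1 c2 c3" by (cases c)
  \<comment> \<open>The imaginary part of the constant coefficient after the translations.\<close>
  define m1 m2 m3 where m: "m1 = a1 - b0 * c1 - c0 * b1" "m2 = a2 - b0 * c2 - c0 * b2"
    "m3 = a3 - b0 * c3 - c0 * b3"
  have a0: "a0 = b0 * c0 - b1 * c1 - b2 * c2 - b3 * c3"
    using uv by (simp add: a b c quat_inner_def)
  have u': "a0 * b0 + a1 * b1 + a2 * b2 + a3 * b3 = c0 * (b0 * b0 + b1 * b1 + b2 * b2 + b3 * b3)"
    using u by (simp add: a b c quat_inner_def)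
  have v': "a0 * c0 + a1 * c1 + a2 * c2 + a3 * c3 = b0 * (c0 * c0 + c1 * c1 + c2 * c2 + c3 * c3)"
    using v by (simp add: a b c quat_inner_def)
  have one': "a0 * a0 + a1 * a1 + a2 * a2 + a3 * a3 =
    (b0 * b0 + b1 * b1 + b2 * b2 + b3 * b3) * (c0 * c0 + c1 * c1 + c2 * c2 + c3 * c3)"
    using one by (simp add: a b c quat_inner_def)
  have mb: "m1 * b1 + m2 * b2 + m3 * b3 = 0"
    using u' unfolding m a0 by (simp add: algebra_simps)
  have mc: "m1 * c1 + m2 * c2 + m3 * c3 = 0"
    using v' unfolding m a0 by (simp add: algebra_simps)
  \<comment> \<open>The square is arranged so that the left sides of \<open>u'\<close>,
    \<open>v'\<close> and \<open>one'\<close> occur verbatim and can be replaced; Lagrange's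
    identity for Im b and Im c then remains.\<close>
  have "m1\<^sup>2 + m2\<^sup>2 + m3\<^sup>2 = (a0 * a0 + a1 * a1 + a2 * a2 + a3 * a3) - a0\<^sup>2
      - 2 * b0 * ((a0 * c0 + a1 * c1 + a2 * c2 + a3 * c3) - a0 * c0)
      - 2 * c0 * ((a0 * b0 + a1 * b1 + a2 * b2 + a3 * b3) - a0 * b0)
      + (b0 * c1 + c0 * b1)\<^sup>2 + (b0 * c2 + c0 * b2)\<^sup>2 + (b0 * c3 + c0 * b3)\<^sup>2"
    unfolding m by (simp add: power2_eq_square algebra_simps)
  also have "\<dots> = (b2 * c3 - b3 * c2)\<^sup>2 + (b3 * c1 - b1 * c3)\<^sup>2 + (b1 * c2 - b2 * c1)\<^sup>2"
    unfolding u' v' one' unfolding a0 by (simp add: power2_eq_square algebra_simps)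
  finally have "m1\<^sup>2 + m2\<^sup>2 + m3\<^sup>2
    = (b2 * c3 - b3 * c2)\<^sup>2 + (b3 * c1 - b1 * c3)\<^sup>2 + (b1 * c2 - b2 * c1)\<^sup>2" .
  from orthogonal_eq_cross_or_minus_cross[OF mb mc this]
  show ?thesis
    by (auto simp: quat_eq_iff a b c a0 m algebra_simps)
qed

text \<open>The hypotheses are quadratic in inner products, so writing each coefficient as d times
  another makes a common factor |d|^4 appear on both sides. Cancelling it leaves the case of leading
  coefficient 1.\<close>

lemma quat_factorization_of_leading:
  assumes "d \<noteq> 0"
    and uv: "quat_inner d d * (quat_inner d a + quat_inner b c) = 2 * (quat_inner d b * quat_inner d c)"
    and u: "quat_inner d d * quat_inner a b = quat_inner d c * quat_inner b b"
    and v: "quat_inner d d * quat_inner a c = quat_inner d b * quat_inner c c"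
    and one: "quat_inner d d * quat_inner a a = quat_inner b b * quat_inner c c"
  obtains b' c' where "b = d * b'" "c = d * c'" "a = d * (c' * b') \<or> a = d * (b' * c')"
proof -
  define a' b' c' where defs: "a' = inverse d * a" "b' = inverse d * b" "c' = inverse d * c"
  have eqs: "a = d * a'" "b = d * b'" "c = d * c'"
    using \<open>d \<noteq> 0\<close> by (simp_all add: defs mult.assoc [symmetric])
  have d: "quat_inner d (d * x) = quat_inner d d * quat_inner 1 x" for x
    using quat_inner_mult_left[of d 1 x] by simp
  have cancel: "x = y" if "quat_inner d d * quat_inner d d * x = quat_inner d d * quat_inner d d * y"
    for x y
    using that quat_inner_self_pos[OF \<open>d \<noteq> 0\<close>] by simp
  have "a' = c' * b' \<or> a' = b' * c'"
  proof (rule quat_eq_mult_or_mult_swap)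
    show "quat_inner 1 a' + quat_inner b' c' = 2 * (quat_inner 1 b' * quat_inner 1 c')"
      using uv unfolding eqs d quat_inner_mult_left
      by - (rule cancel, simp add: algebra_simps)
    show "quat_inner a' b' = quat_inner 1 c' * quat_inner b' b'"
      using u unfolding eqs d quat_inner_mult_left
      by - (rule cancel, simp add: algebra_simps)
    show "quat_inner a' c' = quat_inner 1 b' * quat_inner c' c'"
      using v unfolding eqs d quat_inner_mult_left
      by - (rule cancel, simp add: algebra_simps)
    show "quat_inner a' a' = quat_inner b' b' * quat_inner c' c'"
      using one unfolding eqs d quat_inner_mult_left
      by - (rule cancel, simp add: algebra_simps)
  qed
  with eqs that show ?thesis by blast
qed

section \<open>Coefficients of polynomials in two variables and of their products\<close>

abbreviation (input) monom_uv :: "nat \<Rightarrow> nat \<Rightarrow> 'a::zero \<Rightarrow> 'a bipoly"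
  where "monom_uv m n c \<equiv> Poly_Mapping.single (m, n) c"

abbreviation (input) coeff_uv :: "'a::zero bipoly \<Rightarrow> nat \<Rightarrow> nat \<Rightarrow> 'a"
  where "coeff_uv p m n \<equiv> Poly_Mapping.lookup p (m, n)"

lemma lookup_eq_0_of_bipolys:
  "p \<in> bipolys m n \<Longrightarrow> \<not> (a \<le> m \<and> b \<le> n) \<Longrightarrow> coeff_uv p a b = 0"
  by (auto simp: bipolys_def in_keys_iff)

text \<open>With an explicit sum of monomials, products can be computed by distributivity and
  \<open>mult_single\<close> instead of convolution sums. The coefficient type is general because
  both real and quaternionic polynomials are expanded.\<close>

lemma bipolys_11_expand:
  fixes p :: "'a::monoid_add bipoly"
  assumes "p \<in> bipolys 1 1"
  shows "p = monom_uv 0 0 (coeff_uv p 0 0) + monom_uv 1 0 (coeff_uv p 1 0)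
    + monom_uv 0 1 (coeff_uv p 0 1) + monom_uv 1 1 (coeff_uv p 1 1)"
proof (rule poly_mapping_eqI)
  fix x :: "nat \<times> nat"
  obtain a b where x: "x = (a, b)" by (cases x)
  consider "a \<le> 1 \<and> b \<le> 1" | "\<not> (a \<le> 1 \<and> b \<le> 1)" by blast
  then show "Poly_Mapping.lookup p x = Poly_Mapping.lookup (monom_uv 0 0 (coeff_uv p 0 0)
    + monom_uv 1 0 (coeff_uv p 1 0) + monom_uv 0 1 (coeff_uv p 0 1)
    + monom_uv 1 1 (coeff_uv p 1 1)) x"
    by cases (auto simp: x lookup_add lookup_single when_def le_Suc_eq
      lookup_eq_0_of_bipolys[OF assms])
qed

lemma bipolys_20_expand:
  fixes p :: "'a::monoid_add bipoly"
  assumes "p \<in> bipolys 2 0"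
  shows "p = monom_uv 0 0 (coeff_uv p 0 0) + monom_uv 1 0 (coeff_uv p 1 0)
    + monom_uv 2 0 (coeff_uv p 2 0)"
proof (rule poly_mapping_eqI)
  fix x :: "nat \<times> nat"
  obtain a b where x: "x = (a, b)" by (cases x)
  consider "a \<le> 2 \<and> b \<le> 0" | "\<not> (a \<le> 2 \<and> b \<le> 0)" by blast
  then show "Poly_Mapping.lookup p x = Poly_Mapping.lookup (monom_uv 0 0 (coeff_uv p 0 0)
    + monom_uv 1 0 (coeff_uv p 1 0) + monom_uv 2 0 (coeff_uv p 2 0)) x"
    by cases (auto simp: x lookup_add lookup_single when_def le_Suc_eq numeral_2_eq_2
      lookup_eq_0_of_bipolys[OF assms])
qed

lemma bipolys_02_expand:
  fixes p :: "'a::monoid_add bipoly"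
  assumes "p \<in> bipolys 0 2"
  shows "p = monom_uv 0 0 (coeff_uv p 0 0) + monom_uv 0 1 (coeff_uv p 0 1)
    + monom_uv 0 2 (coeff_uv p 0 2)"
proof (rule poly_mapping_eqI)
  fix x :: "nat \<times> nat"
  obtain a b where x: "x = (a, b)" by (cases x)
  consider "a \<le> 0 \<and> b \<le> 2" | "\<not> (a \<le> 0 \<and> b \<le> 2)" by blast
  then show "Poly_Mapping.lookup p x = Poly_Mapping.lookup (monom_uv 0 0 (coeff_uv p 0 0)
    + monom_uv 0 1 (coeff_uv p 0 1) + monom_uv 0 2 (coeff_uv p 0 2)) x"
    by cases (auto simp: x lookup_add lookup_single when_def le_Suc_eq numeral_2_eq_2
      lookup_eq_0_of_bipolys[OF assms])
qed

text \<open>Positivity of \<open>n\<close> excludes the default 0 inserted in the maximum, so the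
  maximum comes from an actual monomial.\<close>

lemma total_degree_attained:
  assumes "total_degree p = n" "n > 0"
  obtains a b where "coeff_uv p a b \<noteq> 0" "a + b = n"
proof -
  have "Max (insert 0 ((\<lambda>(a, b). a + b) ` Poly_Mapping.keys p))
    \<in> insert 0 ((\<lambda>(a, b). a + b) ` Poly_Mapping.keys p)"
    by (rule Max_in) auto
  then have "n \<in> (\<lambda>(a, b). a + b) ` Poly_Mapping.keys p"
    using assms by (auto simp: total_degree_def)
  then show ?thesis
    using that by (auto simp: in_keys_iff)
qed

lemma total_degree_20_lead:
  assumes "p \<in> bipolys 2 0" "total_degree p = 2"
  shows "coeff_uv p 2 0 \<noteq> 0"
proof -
  obtain a b where ab: "coeff_uv p a b \<noteq> 0" "a + b = 2"
    using assms(2) by (rule total_degree_attained) simp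
  then have "b = 0"
    using lookup_eq_0_of_bipolys[OF assms(1), of a b] by auto
  with ab show ?thesis by simp
qed

lemma total_degree_02_lead:
  assumes "p \<in> bipolys 0 2" "total_degree p = 2"
  shows "coeff_uv p 0 2 \<noteq> 0"
proof -
  obtain a b where ab: "coeff_uv p a b \<noteq> 0" "a + b = 2"
    using assms(2) by (rule total_degree_attained) simp
  then have "a = 0"
    using lookup_eq_0_of_bipolys[OF assms(1), of a b] by auto
  with ab show ?thesis by simp
qed

lemma lookup_square_11:
  fixes p :: "real bipoly"
  assumes "p \<in> bipolys 1 1"
  shows "coeff_uv (p\<^sup>2) 0 0 = (coeff_uv p 0 0)\<^sup>2"
    and "coeff_uv (p\<^sup>2) 1 0 = 2 * (coeff_uv p 0 0 * coeff_uv p 1 0)"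
    and "coeff_uv (p\<^sup>2) 0 1 = 2 * (coeff_uv p 0 0 * coeff_uv p 0 1)"
    and "coeff_uv (p\<^sup>2) 1 1 =
      2 * (coeff_uv p 0 0 * coeff_uv p 1 1) + 2 * (coeff_uv p 1 0 * coeff_uv p 0 1)"
    and "coeff_uv (p\<^sup>2) 2 0 = (coeff_uv p 1 0)\<^sup>2"
    and "coeff_uv (p\<^sup>2) 0 2 = (coeff_uv p 0 1)\<^sup>2"
    and "coeff_uv (p\<^sup>2) 2 1 = 2 * (coeff_uv p 1 0 * coeff_uv p 1 1)"
    and "coeff_uv (p\<^sup>2) 1 2 = 2 * (coeff_uv p 0 1 * coeff_uv p 1 1)"
    and "coeff_uv (p\<^sup>2) 2 2 = (coeff_uv p 1 1)\<^sup>2"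
proof -
  obtain a b c d where p: "p = monom_uv 0 0 a + monom_uv 1 0 b + monom_uv 0 1 c + monom_uv 1 1 d"
    using bipolys_11_expand[OF assms] by blast
  have co: "coeff_uv p 0 0 = a" "coeff_uv p 1 0 = b" "coeff_uv p 0 1 = c" "coeff_uv p 1 1 = d"
    unfolding p by (simp_all add: lookup_add lookup_single when_def)
  have sq: "p\<^sup>2 = monom_uv 0 0 (a * a) + monom_uv 1 0 (a * b + b * a) + monom_uv 0 1 (a * c + c * a)
    + monom_uv 1 1 (a * d + d * a + b * c + c * b) + monom_uv 2 0 (b * b) + monom_uv 0 2 (c * c)
    + monom_uv 2 1 (b * d + d * b) + monom_uv 1 2 (c * d + d * c) + monom_uv 2 2 (d * d)"
    unfolding p power2_eq_square
    by (simp only: distrib_left distrib_right mult_single single_add add_Pair add_0_left add_0_right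
      one_add_one add_ac)
  show "coeff_uv (p\<^sup>2) 0 0 = (coeff_uv p 0 0)\<^sup>2"
    "coeff_uv (p\<^sup>2) 1 0 = 2 * (coeff_uv p 0 0 * coeff_uv p 1 0)"
    "coeff_uv (p\<^sup>2) 0 1 = 2 * (coeff_uv p 0 0 * coeff_uv p 0 1)"
    "coeff_uv (p\<^sup>2) 1 1 =
      2 * (coeff_uv p 0 0 * coeff_uv p 1 1) + 2 * (coeff_uv p 1 0 * coeff_uv p 0 1)"
    "coeff_uv (p\<^sup>2) 2 0 = (coeff_uv p 1 0)\<^sup>2"
    "coeff_uv (p\<^sup>2) 0 2 = (coeff_uv p 0 1)\<^sup>2"
    "coeff_uv (p\<^sup>2) 2 1 = 2 * (coeff_uv p 1 0 * coeff_uv p 1 1)"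
    "coeff_uv (p\<^sup>2) 1 2 = 2 * (coeff_uv p 0 1 * coeff_uv p 1 1)"
    "coeff_uv (p\<^sup>2) 2 2 = (coeff_uv p 1 1)\<^sup>2"
    unfolding co unfolding sq
    by (simp_all add: lookup_add lookup_single when_def power2_eq_square mult.commute)
qed

text \<open>The factors involve different variables, so each monomial of the product arises from
  exactly one pair of monomials.\<close>

lemma lookup_mult_20_02:
  fixes p q :: "real bipoly"
  assumes "p \<in> bipolys 2 0" "q \<in> bipolys 0 2" "i \<le> 2" "j \<le> 2"
  shows "coeff_uv (p * q) i j = coeff_uv p i 0 * coeff_uv q 0 j"
proof -
  obtain a b c where p: "p = monom_uv 0 0 a + monom_uv 1 0 b + monom_uv 2 0 c"
    using bipolys_20_expand[OF assms(1)] by blast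
  obtain a' b' c' where q: "q = monom_uv 0 0 a' + monom_uv 0 1 b' + monom_uv 0 2 c'"
    using bipolys_02_expand[OF assms(2)] by blast
  have "i = 0 \<or> i = 1 \<or> i = 2" "j = 0 \<or> j = 1 \<or> j = 2"
    using assms by auto
  then show ?thesis
    unfolding p q
    by (elim disjE) (simp_all add: algebra_simps mult_single lookup_add lookup_single when_def)
qed

lemma const_bipoly_mult_11:
  fixes p :: "'a::semiring_1 bipoly"
  assumes "p \<in> bipolys 1 1"
  shows "const_bipoly e * p = monom_uv 0 0 (e * coeff_uv p 0 0) + monom_uv 1 0 (e * coeff_uv p 1 0)
    + monom_uv 0 1 (e * coeff_uv p 0 1) + monom_uv 1 1 (e * coeff_uv p 1 1)"
  by (subst bipolys_11_expand[OF assms])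
    (simp add: const_bipoly_def distrib_left mult_single)

lemma quat_bipoly_in_bipolys: "p \<in> bipolys m n \<Longrightarrow> quat_bipoly p \<in> bipolys m n"
  by (auto simp: bipolys_def in_keys_iff)

text \<open>Collects the four real coefficients at each monomial into one quaternion, by
  \<open>Quat_eq\<close>.\<close>

lemma quat_bipoly_combination_11:
  assumes "X1 \<in> bipolys 1 1" "X2 \<in> bipolys 1 1" "X3 \<in> bipolys 1 1" "X4 \<in> bipolys 1 1"
  defines "co \<equiv> \<lambda>m n. Quat (coeff_uv X1 m n) (coeff_uv X2 m n) (coeff_uv X3 m n) (coeff_uv X4 m n)"
  shows "quat_bipoly X1 + const_bipoly quat_i * quat_bipoly X2
      + const_bipoly quat_j * quat_bipoly X3 + const_bipoly quat_k * quat_bipoly X4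
    = monom_uv 0 0 (co 0 0) + monom_uv 1 0 (co 1 0) + monom_uv 0 1 (co 0 1) + monom_uv 1 1 (co 1 1)"
  using assms(1-4)[THEN quat_bipoly_in_bipolys, THEN const_bipoly_mult_11]
  by (subst bipolys_11_expand[OF quat_bipoly_in_bipolys[OF assms(1)]])
    (simp add: co_def Quat_eq single_add algebra_simps)

section \<open>Comparison of coefficients in |Q|^2 = P(u) R(v) and choice of the factors\<close>

theorem corollary1p8:
  fixes X1 X2 X3 X4 X5 X6 :: "real bipoly"
  assumes "X1 \<in> R_polys 1 1" "X2 \<in> R_polys 1 1" "X3 \<in> R_polys 1 1" "X4 \<in> R_polys 1 1"
    and "X5 \<in> R_polys 2 2" "X6 \<in> R_polys 2 2"
    and "X1\<^sup>2 + X2\<^sup>2 + X3\<^sup>2 + X4\<^sup>2 + X5\<^sup>2 = X6\<^sup>2"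
    and "X5 + X6 \<in> R_polys 2 0" "total_degree (X5 + X6) = 2"
    and "X5 - X6 \<in> R_polys 0 2" "total_degree (X5 - X6) = 2"
  shows "\<exists>A \<in> H_polys 1 0. \<exists>B \<in> H_polys 0 1.
    quat_bipoly X1 + const_bipoly quat_i * quat_bipoly X2
      + const_bipoly quat_j * quat_bipoly X3 + const_bipoly quat_k * quat_bipoly X4 = A * B \<or>
    quat_bipoly X1 + const_bipoly quat_i * quat_bipoly X2
      + const_bipoly quat_j * quat_bipoly X3 + const_bipoly quat_k * quat_bipoly X4 = B * A"
proof -
  define co where
    "co m n = Quat (coeff_uv X1 m n) (coeff_uv X2 m n) (coeff_uv X3 m n) (coeff_uv X4 m n)" for m n
  \<comment> \<open>Here P = X5 + X6 and R = X6 - X5; the sign in \<open>r\<close> absorbs the one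
    in X6^2 - X5^2 = -(X5 + X6)(X5 - X6).\<close>
  define p where "p i = coeff_uv (X5 + X6) i 0" for i
  define r where "r i = - coeff_uv (X5 - X6) 0 i" for i
  have "X1\<^sup>2 + X2\<^sup>2 + X3\<^sup>2 + X4\<^sup>2 = - ((X5 + X6) * (X5 - X6))"
    using assms(7) by (simp add: algebra_simps power2_eq_square eq_diff_eq)
  then have eq: "coeff_uv (X1\<^sup>2) i j + coeff_uv (X2\<^sup>2) i j + coeff_uv (X3\<^sup>2) i j + coeff_uv (X4\<^sup>2) i j
      = p i * r j" if "i \<le> 2" "j \<le> 2" for i j
    using lookup_mult_20_02[OF assms(8,10) that]
    by (metis (no_types) lookup_add lookup_uminus mult_minus_right p_def r_def)
  note squares = assms(1-4)[THEN lookup_square_11(1)] assms(1-4)[THEN lookup_square_11(2)]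
    assms(1-4)[THEN lookup_square_11(3)] assms(1-4)[THEN lookup_square_11(4)]
    assms(1-4)[THEN lookup_square_11(5)] assms(1-4)[THEN lookup_square_11(6)]
    assms(1-4)[THEN lookup_square_11(7)] assms(1-4)[THEN lookup_square_11(8)]
    assms(1-4)[THEN lookup_square_11(9)]
  define a b c d where abcd: "a = co 0 0" "b = co 1 0" "c = co 0 1" "d = co 1 1"
  note inner = abcd co_def quat_inner_def quat.sel
  \<comment> \<open>These are the coefficients of |Q|^2 at all nine monomials; the halves arise
    because mixed products occur twice in a square.\<close>
  have coeffs:
    "quat_inner a a = p 0 * r 0"
    "quat_inner a b = p 1 * r 0 / 2"
    "quat_inner a c = p 0 * r 1 / 2"
    "quat_inner d a + quat_inner b c = p 1 * r 1 / 2"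
    "quat_inner b b = p 2 * r 0"
    "quat_inner c c = p 0 * r 2"
    "quat_inner d b = p 2 * r 1 / 2"
    "quat_inner d c = p 1 * r 2 / 2"
    "quat_inner d d = p 2 * r 2"
    unfolding inner
    subgoal using eq[of 0 0] unfolding squares by (simp add: power2_eq_square algebra_simps)
    subgoal using eq[of 1 0] unfolding squares by (simp add: power2_eq_square algebra_simps)
    subgoal using eq[of 0 1] unfolding squares by (simp add: power2_eq_square algebra_simps)
    subgoal using eq[of 1 1] unfolding squares by (simp add: power2_eq_square algebra_simps)
    subgoal using eq[of 2 0] unfolding squares by (simp add: power2_eq_square algebra_simps)
    subgoal using eq[of 0 2] unfolding squares by (simp add: power2_eq_square algebra_simps)
    subgoal using eq[of 2 1] unfolding squares by (simp add: power2_eq_square algebra_simps)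
    subgoal using eq[of 1 2] unfolding squares by (simp add: power2_eq_square algebra_simps)
    subgoal using eq[of 2 2] unfolding squares by (simp add: power2_eq_square algebra_simps)
    done
  \<comment> \<open>The degree hypotheses make both leading coefficients nonzero, and their product
    is |d|^2.\<close>
  have "p 2 \<noteq> 0" "r 2 \<noteq> 0"
    unfolding p_def r_def using total_degree_20_lead total_degree_02_lead assms(8-11) by simp_all
  then have "quat_inner d d \<noteq> 0"
    using coeffs by simp
  then have "d \<noteq> 0"
    by (auto simp: quat_inner_def)
  \<comment> \<open>Eliminating \<open>p\<close> and \<open>r\<close>: both sides of each equation
    are the same product of two values of \<open>p\<close> and two of \<open>r\<close>, grouped
    differently.\<close>
  moreover have
    "quat_inner d d * (quat_inner d a + quat_inner b c) = 2 * (quat_inner d b * quat_inner d c)"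
    "quat_inner d d * quat_inner a b = quat_inner d c * quat_inner b b"
    "quat_inner d d * quat_inner a c = quat_inner d b * quat_inner c c"
    "quat_inner d d * quat_inner a a = quat_inner b b * quat_inner c c"
    unfolding coeffs by (simp_all add: algebra_simps)
  ultimately obtain b' c' where b: "b = d * b'" and c: "c = d * c'"
    and a: "a = d * (c' * b') \<or> a = d * (b' * c')"
    by (rule quat_factorization_of_leading)
  have Q: "quat_bipoly X1 + const_bipoly quat_i * quat_bipoly X2
      + const_bipoly quat_j * quat_bipoly X3 + const_bipoly quat_k * quat_bipoly X4
    = monom_uv 0 0 a + monom_uv 1 0 b + monom_uv 0 1 c + monom_uv 1 1 d"
    unfolding abcd co_def using assms(1-4) by (rule quat_bipoly_combination_11)
  have mem: "monom_uv 1 0 x + monom_uv 0 0 y \<in> H_polys 1 0"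
    "monom_uv 0 1 x + monom_uv 0 0 y \<in> H_polys 0 1" for x y :: quat
    by (auto simp: bipolys_def in_keys_iff lookup_add lookup_single when_def split: if_splits)
  from a show ?thesis
  proof
    assume "a = d * (c' * b')"
    \<comment> \<open>Q = d (u + c') (v + b'), with d absorbed into the left factor; this is the
      order AB.\<close>
    then have "monom_uv 0 0 a + monom_uv 1 0 b + monom_uv 0 1 c + monom_uv 1 1 d
      = (monom_uv 1 0 d + monom_uv 0 0 (d * c')) * (monom_uv 0 1 1 + monom_uv 0 0 b')"
      by (simp add: b c algebra_simps mult_single)
    then show ?thesis
      unfolding Q using mem by blast
  next
    assume "a = d * (b' * c')"
    \<comment> \<open>Q = d (v + b') (u + c'), so the left factor, again absorbing d, is the one in
      v; this is the order BA.\<close>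
    then have "monom_uv 0 0 a + monom_uv 1 0 b + monom_uv 0 1 c + monom_uv 1 1 d
      = (monom_uv 0 1 d + monom_uv 0 0 (d * b')) * (monom_uv 1 0 1 + monom_uv 0 0 c')"
      by (simp add: b c algebra_simps mult_single)
    then show ?thesis
      unfolding Q using mem by blast
  qed
qed

end
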